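(* Let $d,n_1,\dots,n_d$ be positive integers and let $S\subseteq[n_1]\times\cdots\times[n_d]$. The set of partial tensors subordinate to the pattern $S$ that are completable to rank-one tensors in the standard simplex is a semialgebraic subset of $\mathbb{R}^S$.
   Context: $[n]=\{1,\dots,n\}$. A partial tensor of format $n_1\times\cdots\times n_d$ subordinate to the pattern $S$ is one in which exactly the entries in positions $S$ are specified, i.e. a point of $\mathbb{R}^S$. It is completable to a rank-one tensor in the standard simplex if its unspecified entries can be filled in to give a real tensor of rank one with nonnegative entries summing to one. *)

theory Defs
  imports Complex_Main "HOL-Library.FuncSet"
begin

text \<open>
  Coordinate spaces \<open>\<real>\<^sup>I\<close> are rendered as the sets \<open>I \<rightarrow>\<^sub>E UNIV\<close> of extensional functions from
  \<open>I\<close> to the reals, so that two points agreeing on \<open>I\<close> are equal.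
\<close>

abbreviation coord_space :: "'i set \<Rightarrow> ('i \<Rightarrow> real) set"
  where "coord_space I \<equiv> I \<rightarrow>\<^sub>E UNIV"

text \<open>
  Functions given by a polynomial with real coefficients in the variables \<open>x i\<close>, \<open>i \<in> I\<close>
  (cf. \<open>real_polynomial_function\<close> in \<open>HOL-Analysis\<close>, whose domain is a whole type).
\<close>

inductive polynomial_fun_on :: "'i set \<Rightarrow> (('i \<Rightarrow> real) \<Rightarrow> real) \<Rightarrow> bool"
  for I :: "'i set" where
  const: "polynomial_fun_on I (\<lambda>x. c)"
| coord: "i \<in> I \<Longrightarrow> polynomial_fun_on I (\<lambda>x. x i)"
| add: "polynomial_fun_on I p \<Longrightarrow> polynomial_fun_on I q \<Longrightarrow> polynomial_fun_on I (\<lambda>x. p x + q x)"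
| mult: "polynomial_fun_on I p \<Longrightarrow> polynomial_fun_on I q \<Longrightarrow> polynomial_fun_on I (\<lambda>x. p x * q x)"

text \<open>
  The semialgebraic subsets of \<open>\<real>\<^sup>I\<close> (for finite \<open>I\<close>): the Boolean algebra of subsets of \<open>\<real>\<^sup>I\<close>
  generated by the sets \<open>{p > 0}\<close>, for \<open>p\<close> a real polynomial. Equations \<open>p = 0\<close> and weak
  inequalities are obtained from complements and intersections.
\<close>

inductive semialgebraic :: "'i set \<Rightarrow> ('i \<Rightarrow> real) set \<Rightarrow> bool"
  for I :: "'i set" where
  positive: "polynomial_fun_on I p \<Longrightarrow> semialgebraic I {x \<in> coord_space I. p x > 0}"
| union: "semialgebraic I A \<Longrightarrow> semialgebraic I B \<Longrightarrow> semialgebraic I (A \<union> B)"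
| inter: "semialgebraic I A \<Longrightarrow> semialgebraic I B \<Longrightarrow> semialgebraic I (A \<inter> B)"
| compl: "semialgebraic I A \<Longrightarrow> semialgebraic I (coord_space I - A)"

text \<open>
  The index set \<open>[n\<^sub>1] \<times> \<dots> \<times> [n\<^sub>d]\<close>; a multi-index is an extensional function on \<open>{1..d}\<close>.
\<close>

definition positions :: "nat \<Rightarrow> (nat \<Rightarrow> nat) \<Rightarrow> (nat \<Rightarrow> nat) set"
  where "positions d n = (\<Pi>\<^sub>E k\<in>{1..d}. {1..n k})"

definition tensors :: "nat \<Rightarrow> (nat \<Rightarrow> nat) \<Rightarrow> ((nat \<Rightarrow> nat) \<Rightarrow> real) set"
  where "tensors d n = coord_space (positions d n)"

text \<open>
  Rank one means rank exactly one: a nonzero outer product \<open>v\<^sub>1 \<otimes> \<dots> \<otimes> v\<^sub>d\<close> of real vectors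
  \<open>v\<^sub>k \<in> \<real>\<^bsup>n\<^sub>k\<^esup>\<close>. Only the values \<open>v k j\<close> with \<open>1 \<le> k \<le> d\<close> and \<open>1 \<le> j \<le> n k\<close> matter.
\<close>

definition rank_one :: "nat \<Rightarrow> (nat \<Rightarrow> nat) \<Rightarrow> ((nat \<Rightarrow> nat) \<Rightarrow> real) \<Rightarrow> bool"
  where "rank_one d n t \<longleftrightarrow>
    (\<exists>i\<in>positions d n. t i \<noteq> 0) \<and>
    (\<exists>v :: nat \<Rightarrow> nat \<Rightarrow> real. \<forall>i\<in>positions d n. t i = (\<Prod>k\<in>{1..d}. v k (i k)))"

definition standard_simplex :: "nat \<Rightarrow> (nat \<Rightarrow> nat) \<Rightarrow> ((nat \<Rightarrow> nat) \<Rightarrow> real) set"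
  where "standard_simplex d n =
    {t \<in> tensors d n. (\<forall>i\<in>positions d n. t i \<ge> 0) \<and> (\<Sum>i\<in>positions d n. t i) = 1}"

definition completable ::
    "nat \<Rightarrow> (nat \<Rightarrow> nat) \<Rightarrow> (nat \<Rightarrow> nat) set \<Rightarrow> ((nat \<Rightarrow> nat) \<Rightarrow> real) \<Rightarrow> bool"
  where "completable d n S x \<longleftrightarrow>
    (\<exists>t \<in> standard_simplex d n. rank_one d n t \<and> (\<forall>i\<in>S. t i = x i))"

end

theory Submission
  imports Defs "HOL-Computational_Algebra.Polynomial"
begin

text \<open>
  A partial tensor is completable exactly if it is the restriction to \<open>S\<close> of a rank-one tensor in the
  simplex. Such tensors form a semialgebraic set, because a tensor with entry sum \<open>1\<close> has rank one if
  and only if it is the outer product of its marginals (\<open>rank_one_iff_product_of_marginals\<close>), which is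
  a system of polynomial equations. Restriction to \<open>S\<close> is a coordinate projection, so the claim
  follows from the Tarski--Seidenberg theorem (\<open>tarski_seidenberg\<close>): projections of semialgebraic
  sets are semialgebraic. Most of the text below proves that theorem.

  It suffices to project along one coordinate \<open>t\<close>. A semialgebraic set is then described by the
  signs of finitely many polynomials in \<open>t\<close> whose coefficients are polynomials in the remaining
  variables \<open>x\<close>. If the roots of these polynomials were functions of \<open>x\<close> that may be used in sign
  conditions as freely as polynomials, then \<open>\<exists>t\<close> could be replaced by a finite disjunction over the
  roots, midpoints of roots and points beyond all roots.

  Zorn's lemma provides such functions. Among the rings of functions of \<open>x\<close> that contain the
  polynomials and whose members all have semialgebraic positivity sets, let \<open>R\<close> be a maximal one
  (\<open>ex_maximal_positivity_ring\<close>). If a function \<open>f\<close> is such that \<open>Q(f)\<close> has a semialgebraic positivity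
  set for all \<open>Q \<in> R[t]\<close>, then \<open>f \<in> R\<close> (\<open>effective_mem\<close>). This is used to show, by induction on
  the degree, that the roots of every polynomial over \<open>R\<close> are traced by finitely many members of \<open>R\<close>
  (\<open>monic_root_cover\<close>, \<open>ex_root_cover\<close>): the roots of \<open>P\<close> are isolated by those of \<open>P'\<close>, which are in \<open>R\<close> by induction,
  and at a root of \<open>P\<close> a polynomial \<open>Q\<close> can be replaced by its remainder modulo \<open>P\<close>, whose roots are
  again in \<open>R\<close>. The sign of the remainder at an isolated root of \<open>P\<close> can be read off from signs at
  known points (\<open>sign_at_isolated_root\<close>). The induction follows Cohen's proof of quantifier
  elimination, with the maximal ring in place of effective functions.
\<close>

section \<open>Rings of functions and their positivity sets\<close>

text \<open>
  The model to have in mind is the ring of polynomial functions on \<open>\<real>\<^sup>I\<close> with the algebra of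
  semialgebraic sets. Separating the two allows \<open>R\<close> to grow beyond the polynomials while \<open>B\<close> stays the
  same.
\<close>

locale positivity_ring =
  fixes B :: "'x set set" and R :: "('x \<Rightarrow> real) set"
  assumes compl_mem: "A \<in> B \<Longrightarrow> - A \<in> B"
    and inter_mem: "A \<in> B \<Longrightarrow> A' \<in> B \<Longrightarrow> A \<inter> A' \<in> B"
    and const_mem: "(\<lambda>x. c) \<in> R"
    and add_mem: "f \<in> R \<Longrightarrow> g \<in> R \<Longrightarrow> (\<lambda>x. f x + g x) \<in> R"
    and mult_mem: "f \<in> R \<Longrightarrow> g \<in> R \<Longrightarrow> (\<lambda>x. f x * g x) \<in> R"
    and pos_mem: "f \<in> R \<Longrightarrow> {x. 0 < f x} \<in> B"
begin

lemma B_not: "{x. P x} \<in> B \<Longrightarrow> {x. \<not> P x} \<in> B"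
  using compl_mem[of "{x. P x}"] by (simp add: Collect_neg_eq)

lemma B_conj: "{x. P x} \<in> B \<Longrightarrow> {x. Q x} \<in> B \<Longrightarrow> {x. P x \<and> Q x} \<in> B"
  using inter_mem[of "{x. P x}" "{x. Q x}"] by (simp add: Collect_conj_eq)

lemma B_disj: "{x. P x} \<in> B \<Longrightarrow> {x. Q x} \<in> B \<Longrightarrow> {x. P x \<or> Q x} \<in> B"
  using B_not[OF B_conj[OF B_not B_not, of P Q]] by simp

lemma B_True: "{x. True} \<in> B"
  using pos_mem[OF const_mem[of 1]] by simp

lemma B_False: "{x. False} \<in> B"
  using B_not[OF B_True] by simp

lemma B_bex: "finite E \<Longrightarrow> (\<And>e. e \<in> E \<Longrightarrow> {x. P e x} \<in> B) \<Longrightarrow> {x. \<exists>e\<in>E. P e x} \<in> B"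
proof (induction E rule: finite_induct)
  case empty
  then show ?case using B_False by simp
next
  case (insert a E)
  then show ?case using B_disj[of "P a" "\<lambda>x. \<exists>e\<in>E. P e x"] by simp
qed

lemma B_ball: "finite E \<Longrightarrow> (\<And>e. e \<in> E \<Longrightarrow> {x. P e x} \<in> B) \<Longrightarrow> {x. \<forall>e\<in>E. P e x} \<in> B"
  using B_not[OF B_bex[of E "\<lambda>e x. \<not> P e x"]] B_not by simp

lemma uminus_mem: "f \<in> R \<Longrightarrow> (\<lambda>x. - f x) \<in> R"
  using mult_mem[OF const_mem[of "-1"]] by simp

lemma diff_mem: "f \<in> R \<Longrightarrow> g \<in> R \<Longrightarrow> (\<lambda>x. f x - g x) \<in> R"
  using add_mem[OF _ uminus_mem] by simp

lemma power_mem: "f \<in> R \<Longrightarrow> (\<lambda>x. f x ^ n) \<in> R"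
  by (induction n) (simp_all add: const_mem mult_mem)

lemma sum_mem: "(\<And>i. i \<in> A \<Longrightarrow> f i \<in> R) \<Longrightarrow> (\<lambda>x. \<Sum>i\<in>A. f i x) \<in> R"
  by (induction A rule: infinite_finite_induct) (simp_all add: const_mem add_mem)

lemma B_less: "f \<in> R \<Longrightarrow> g \<in> R \<Longrightarrow> {x. f x < g x} \<in> B"
  using pos_mem[OF diff_mem[of g f]] by simp

lemma B_le: "f \<in> R \<Longrightarrow> g \<in> R \<Longrightarrow> {x. f x \<le> g x} \<in> B"
  using B_not[OF B_less[of g f]] by (simp add: not_less)

lemma B_eq: "f \<in> R \<Longrightarrow> g \<in> R \<Longrightarrow> {x. f x = g x} \<in> B"
  using B_conj[OF B_le B_le, of f g g f] by (simp add: order_eq_iff)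

text \<open>
  Polynomials in one variable over \<open>R\<close>, seen as maps from points to real polynomials. The
  bound \<open>n\<close> on the degree is uniform in the point, but the actual degree may drop at some points.
\<close>

definition poly_family :: "nat \<Rightarrow> ('x \<Rightarrow> real poly) \<Rightarrow> bool"
  where "poly_family n Q \<longleftrightarrow> (\<forall>i. (\<lambda>x. coeff (Q x) i) \<in> R) \<and> (\<forall>x. degree (Q x) \<le> n)"

lemma poly_familyI:
  assumes "\<And>i. i \<le> n \<Longrightarrow> (\<lambda>x. coeff (Q x) i) \<in> R" and "\<And>i x. n < i \<Longrightarrow> coeff (Q x) i = 0"
  shows "poly_family n Q"
  unfolding poly_family_def
proof (intro conjI allI)
  show "(\<lambda>x. coeff (Q x) i) \<in> R" for i
    using assms const_mem[of 0] by (cases "i \<le> n") auto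
  show "degree (Q x) \<le> n" for x
    using assms(2) by (intro degree_le) auto
qed

lemma poly_family_coeff: "poly_family n Q \<Longrightarrow> (\<lambda>x. coeff (Q x) i) \<in> R"
  by (simp add: poly_family_def)

lemma poly_family_degree: "poly_family n Q \<Longrightarrow> degree (Q x) \<le> n"
  by (simp add: poly_family_def)

lemma poly_family_coeff_0: "poly_family n Q \<Longrightarrow> n < i \<Longrightarrow> coeff (Q x) i = 0"
  using poly_family_degree[of n Q x] by (intro coeff_eq_0) simp

lemma poly_family_poly_eq: "poly_family n Q \<Longrightarrow> poly (Q x) t = (\<Sum>i\<le>n. coeff (Q x) i * t ^ i)"
  unfolding poly_altdef
  by (rule sum.mono_neutral_left) (auto dest: poly_family_degree[of n Q x] intro: coeff_eq_0)

lemma eval_mem: "poly_family n Q \<Longrightarrow> f \<in> R \<Longrightarrow> (\<lambda>x. poly (Q x) (f x)) \<in> R"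
  by (simp add: poly_family_poly_eq sum_mem mult_mem power_mem poly_family_coeff)

lemma poly_family_const: "f \<in> R \<Longrightarrow> poly_family 0 (\<lambda>x. [:f x:])"
  by (rule poly_familyI) (auto simp: coeff_pCons split: nat.split)

lemma poly_family_var: "poly_family 1 (\<lambda>x. [:0, 1:])"
  by (rule poly_familyI) (auto simp: coeff_pCons const_mem split: nat.split)

lemma poly_family_mono: "poly_family n Q \<Longrightarrow> n \<le> m \<Longrightarrow> poly_family m Q"
  by (auto simp: poly_family_def intro: order_trans)

lemma poly_family_add: "poly_family n P \<Longrightarrow> poly_family m Q \<Longrightarrow> poly_family (max n m) (\<lambda>x. P x + Q x)"
  by (rule poly_familyI) (auto simp: add_mem poly_family_coeff poly_family_coeff_0)

lemma poly_family_mult: "poly_family n P \<Longrightarrow> poly_family m Q \<Longrightarrow> poly_family (n + m) (\<lambda>x. P x * Q x)"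
  unfolding poly_family_def coeff_mult
  by (intro conjI allI sum_mem mult_mem order_trans[OF degree_mult_le] add_mono) simp_all

end

section \<open>Maximal rings with prescribed positivity sets\<close>

locale maximal_positivity_ring = positivity_ring B R
  for B :: "'x set set" and R :: "('x \<Rightarrow> real) set" +
  assumes maximal: "positivity_ring B R' \<Longrightarrow> R \<subseteq> R' \<Longrightarrow> R' = R"

lemma positivity_ring_Union:
  assumes "\<C> \<noteq> {}" and "\<And>R R'. R \<in> \<C> \<Longrightarrow> R' \<in> \<C> \<Longrightarrow> R \<subseteq> R' \<or> R' \<subseteq> R"
    and "\<And>R. R \<in> \<C> \<Longrightarrow> positivity_ring B R"
  shows "positivity_ring B (\<Union>\<C>)"
proof -
  obtain R0 where R0: "R0 \<in> \<C>" using assms(1) by blast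
  interpret R0: positivity_ring B R0 using assms(3)[OF R0] .
  have common: "\<exists>R\<in>\<C>. f \<in> R \<and> g \<in> R" if "f \<in> \<Union>\<C>" "g \<in> \<Union>\<C>" for f g
    using that assms(2) by blast
  show ?thesis
  proof
    show "(\<lambda>x. c) \<in> \<Union>\<C>" for c
      using R0 R0.const_mem by blast
    show "(\<lambda>x. f x + g x) \<in> \<Union>\<C>" if "f \<in> \<Union>\<C>" "g \<in> \<Union>\<C>" for f g
      using common[OF that] assms(3) positivity_ring.add_mem by blast
    show "(\<lambda>x. f x * g x) \<in> \<Union>\<C>" if "f \<in> \<Union>\<C>" "g \<in> \<Union>\<C>" for f g
      using common[OF that] assms(3) positivity_ring.mult_mem by blast
    show "{x. 0 < f x} \<in> B" if "f \<in> \<Union>\<C>" for f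
      using that assms(3) positivity_ring.pos_mem by blast
  qed (auto intro: R0.compl_mem R0.inter_mem)
qed

text \<open>
  Each ring axiom involves at most two members, and two members of the union of a chain lie in a
  common ring of the chain; so Zorn's lemma applies.
\<close>

lemma ex_maximal_positivity_ring:
  assumes "positivity_ring B R\<^sub>0"
  shows "\<exists>R. R\<^sub>0 \<subseteq> R \<and> maximal_positivity_ring B R"
proof -
  let ?F = "{R. R\<^sub>0 \<subseteq> R \<and> positivity_ring B R}"
  have "\<exists>M\<in>?F. \<forall>X\<in>?F. M \<subseteq> X \<longrightarrow> X = M"
  proof (rule subset_Zorn_nonempty)
    show "?F \<noteq> {}" using assms by blast
    fix \<C> assume \<C>: "\<C> \<noteq> {}" "subset.chain ?F \<C>"
    then have sub: "\<And>R. R \<in> \<C> \<Longrightarrow> R\<^sub>0 \<subseteq> R \<and> positivity_ring B R"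
      and chain: "\<And>R R'. R \<in> \<C> \<Longrightarrow> R' \<in> \<C> \<Longrightarrow> R \<subseteq> R' \<or> R' \<subseteq> R"
      by (auto simp: subset_chain_def)
    have "R\<^sub>0 \<subseteq> \<Union>\<C>" using sub \<C>(1) by blast
    then show "\<Union>\<C> \<in> ?F"
      using positivity_ring_Union[OF \<C>(1) chain, of B] sub by simp
  qed
  then obtain M where M: "R\<^sub>0 \<subseteq> M" "positivity_ring B M"
    and max: "\<forall>X\<in>?F. M \<subseteq> X \<longrightarrow> X = M"
    by auto
  have "X = M" if "positivity_ring B X" "M \<subseteq> X" for X
    using max M(1) that by (metis (no_types, lifting) mem_Collect_eq order_trans)
  with M(2) have "maximal_positivity_ring B M"
    by (simp add: maximal_positivity_ring_def maximal_positivity_ring_axioms_def)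
  with M(1) show ?thesis by blast
qed

context maximal_positivity_ring
begin

text \<open>
  How maximality is used: if the sign of every \<open>Q(f)\<close> with \<open>Q \<in> R[t]\<close> is decided by \<open>B\<close>, then
  adjoining \<open>f\<close> gives a ring \<open>R[f]\<close> whose positivity sets still lie in \<open>B\<close>, hence \<open>f\<close> was
  already in \<open>R\<close>. The condition is modelled on the effective functions of Cohen's proof of
  quantifier elimination.
\<close>

lemma effective_mem:
  assumes pos: "\<And>n Q. poly_family n Q \<Longrightarrow> {x. 0 < poly (Q x) (f x)} \<in> B"
  shows "f \<in> R"
proof -
  define R' where "R' = {g. \<exists>n Q. poly_family n Q \<and> g = (\<lambda>x. poly (Q x) (f x))}"
  have R': "(\<lambda>x. poly (Q x) (f x)) \<in> R'" if "poly_family n Q" for n Q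
    using that R'_def by blast
  have "positivity_ring B R'"
  proof
    show "(\<lambda>x. c) \<in> R'" for c
      using R'[OF poly_family_const[OF const_mem[of c]]] by simp
    show "(\<lambda>x. g x + h x) \<in> R'" if "g \<in> R'" "h \<in> R'" for g h
      using that R'[OF poly_family_add] by (auto simp: R'_def)
    show "(\<lambda>x. g x * h x) \<in> R'" if "g \<in> R'" "h \<in> R'" for g h
      using that R'[OF poly_family_mult] by (auto simp: R'_def)
    show "{x. 0 < g x} \<in> B" if "g \<in> R'" for g
      using that pos by (auto simp: R'_def)
  qed (auto intro: compl_mem inter_mem)
  moreover have "R \<subseteq> R'"
  proof
    fix g assume "g \<in> R"
    then show "g \<in> R'" using R'[OF poly_family_const[of g]] by simp
  qed
  moreover have "f \<in> R'"
    using R'[OF poly_family_var] by simp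
  ultimately show ?thesis using maximal by blast
qed

text \<open>
  Multiplying \<open>Q(1 / f)\<close> by the even power \<open>f\<^bsup>2n\<^esup>\<close> clears the denominators without changing the sign.
  Where \<open>f\<close> vanishes, the inverse is \<open>0\<close> and only the constant coefficient of \<open>Q\<close> remains.
\<close>

lemma inverse_mem:
  assumes f: "f \<in> R"
  shows "(\<lambda>x. inverse (f x)) \<in> R"
proof (rule effective_mem)
  fix n Q assume Q: "poly_family n Q"
  have eq: "0 < poly (Q x) (inverse (f x)) \<longleftrightarrow>
      (f x = 0 \<and> 0 < coeff (Q x) 0) \<or>
      (\<not> f x = 0 \<and> 0 < (\<Sum>i\<le>n. coeff (Q x) i * f x ^ (2 * n - i)))" for x
  proof (cases "f x = 0")
    case True
    then show ?thesis by (simp add: poly_0_coeff_0)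
  next
    case False
    have "f x ^ (2 * n) * poly (Q x) (inverse (f x)) =
        (\<Sum>i\<le>n. coeff (Q x) i * (f x ^ (2 * n) * inverse (f x) ^ i))"
      by (simp add: poly_family_poly_eq[OF Q] sum_distrib_left mult.left_commute)
    also have "\<dots> = (\<Sum>i\<le>n. coeff (Q x) i * f x ^ (2 * n - i))"
    proof (intro sum.cong refl arg_cong2[of _ _ _ _ "(*)"])
      fix i assume "i \<in> {..n}"
      then have "f x ^ (2 * n) = f x ^ (2 * n - i) * f x ^ i"
        by (simp flip: power_add)
      then show "f x ^ (2 * n) * inverse (f x) ^ i = f x ^ (2 * n - i)"
        using False by (simp add: power_inverse)
    qed
    moreover have "0 < f x ^ (2 * n)"
      using False by (simp add: zero_less_power_eq)
    ultimately show ?thesis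
      using False by (metis zero_less_mult_pos zero_less_mult_iff)
  qed
  show "{x. 0 < poly (Q x) (inverse (f x))} \<in> B"
    unfolding eq
    by (intro B_disj B_conj B_not B_eq B_less sum_mem mult_mem power_mem f const_mem
        poly_family_coeff[OF Q])
qed

end

section \<open>Signs of real polynomials\<close>

lemma poly_root_between:
  fixes p :: "real poly"
  assumes "a < b" "poly p a * poly p b < 0"
  shows "\<exists>t. a < t \<and> t < b \<and> poly p t = 0"
  using assms poly_IVT_pos[of a b p] poly_IVT_neg[of a b p]
  by (auto simp: mult_less_0_iff)

lemma poly_sgn_constant:
  fixes p :: "real poly"
  assumes no_root: "\<And>u. min s t \<le> u \<Longrightarrow> u \<le> max s t \<Longrightarrow> poly p u \<noteq> 0"
  shows "sgn (poly p s) = sgn (poly p t)"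
proof (rule ccontr)
  assume ne: "sgn (poly p s) \<noteq> sgn (poly p t)"
  have "poly p s \<noteq> 0" "poly p t \<noteq> 0" using no_root[of s] no_root[of t] by auto
  with ne have "poly p (min s t) * poly p (max s t) < 0"
    by (auto simp: min_def max_def mult_less_0_iff sgn_if split: if_splits)
  moreover have "min s t < max s t" using ne by (cases "s = t") (auto simp: min_def max_def)
  ultimately obtain u where "min s t < u" "u < max s t" "poly p u = 0"
    using poly_root_between by blast
  then show False using no_root[of u] by simp
qed

text \<open>
  The sign of \<open>q\<close> at the only root \<open>r\<close> of \<open>p\<close> in \<open>(a, b)\<close>, expressed without mentioning \<open>r\<close>: only the
  signs of \<open>p\<close> and \<open>q\<close> at \<open>a\<close>, \<open>b\<close>, the points of a finite set \<open>W\<close> that contains the roots of a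
  nonzero \<open>q\<close>, and midpoints of these occur. Either \<open>r\<close> is one of the points of \<open>W\<close>, or it lies
  strictly between two neighbouring points \<open>c\<close> and \<open>d\<close>. The latter case is detected by a sign change
  of \<open>p\<close>, and there a nonzero \<open>q\<close> has the same sign at \<open>r\<close> as at the midpoint, since it has no root
  between \<open>c\<close> and \<open>d\<close>.
\<close>

lemma sign_at_isolated_root:
  fixes p q :: "real poly" and W :: "real set"
  assumes r: "a < r" "r < b" "poly p r = 0"
    and unique: "\<And>t. a < t \<Longrightarrow> t < b \<Longrightarrow> poly p t = 0 \<Longrightarrow> t = r"
    and ab: "poly p a * poly p b < 0"
    and W: "finite W" "\<And>t. q \<noteq> 0 \<Longrightarrow> poly q t = 0 \<Longrightarrow> t \<in> W"
  shows "0 < poly q r \<longleftrightarrow>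
    (\<exists>w\<in>W. (a < w \<and> w < b) \<and> poly p w = 0 \<and> 0 < poly q w) \<or>
    (\<exists>c\<in>insert a (insert b W). \<exists>d\<in>insert a (insert b W).
      (a \<le> c \<and> c < d \<and> d \<le> b) \<and> poly p c * poly p d < 0 \<and>
      (\<forall>w\<in>W. \<not> (c < w \<and> w < d)) \<and> 0 < poly q ((c + d) / 2))" (is "_ \<longleftrightarrow> ?root \<or> ?gap")
proof
  assume "?root \<or> ?gap"
  then show "0 < poly q r"
  proof
    assume ?root
    then show ?thesis using unique by auto
  next
    assume ?gap
    then obtain c d where cd: "a \<le> c" "c < d" "d \<le> b" "poly p c * poly p d < 0"
      and gap: "\<And>w. w \<in> W \<Longrightarrow> \<not> (c < w \<and> w < d)" and mid: "0 < poly q ((c + d) / 2)"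
      by blast
    obtain t where t: "c < t" "t < d" "poly p t = 0"
      using poly_root_between[OF cd(2,4)] by blast
    with unique[of t] cd have rcd: "c < r" "r < d" by auto
    have "sgn (poly q ((c + d) / 2)) = sgn (poly q r)"
    proof (rule poly_sgn_constant)
      fix u assume "min ((c + d) / 2) r \<le> u" "u \<le> max ((c + d) / 2) r"
      then have "c < u" "u < d" using rcd by (auto simp: min_def max_def split: if_splits)
      then show "poly q u \<noteq> 0" using W(2)[of u] gap[of u] mid by (cases "q = 0") auto
    qed
    then show ?thesis using mid by (metis sgn_greater)
  qed
next
  assume pos: "0 < poly q r"
  show "?root \<or> ?gap"
  proof (cases "r \<in> W")
    case True
    then show ?thesis using r pos by blast
  next
    case False
    let ?V = "insert a (insert b (W \<inter> {a..b}))"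
    define c where "c = Max {w\<in>?V. w < r}"
    define d where "d = Min {w\<in>?V. r < w}"
    have fin: "finite {w\<in>?V. w < r}" "finite {w\<in>?V. r < w}" using W(1) by auto
    have ne: "{w\<in>?V. w < r} \<noteq> {}" "{w\<in>?V. r < w} \<noteq> {}" using r by auto
    have c: "c \<in> {w\<in>?V. w < r}" unfolding c_def by (rule Max_in[OF fin(1) ne(1)])
    have d: "d \<in> {w\<in>?V. r < w}" unfolding d_def by (rule Min_in[OF fin(2) ne(2)])
    have ac: "a \<le> c" "c < r" "c \<in> insert a (insert b W)" using c r by auto
    have db: "d \<le> b" "r < d" "d \<in> insert a (insert b W)" using d r by auto
    have cge: "w \<le> c" if "w \<in> ?V" "w < r" for w
      unfolding c_def using that by (intro Max_ge[OF fin(1)]) auto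
    have dle: "d \<le> w" if "w \<in> ?V" "r < w" for w
      unfolding d_def using that by (intro Min_le[OF fin(2)]) auto
    have gap: "\<not> (c < w \<and> w < d)" if "w \<in> W" for w
    proof
      assume w: "c < w \<and> w < d"
      then have "w \<in> ?V" using that ac db by auto
      then show False using cge[of w] dle[of w] w False that by (cases w r rule: linorder_cases) auto
    qed
    have p0: "poly p u \<noteq> 0" if "a \<le> u" "u \<le> b" "u \<noteq> r" for u
      using unique[of u] that ab by (cases "u = a \<or> u = b") auto
    have sc: "sgn (poly p a) = sgn (poly p c)"
      using ac r by (intro poly_sgn_constant p0) auto
    have sd: "sgn (poly p d) = sgn (poly p b)"
      using db r by (intro poly_sgn_constant p0) auto
    have cd: "poly p c * poly p d < 0"
      using ab sc sd by (auto simp: sgn_if mult_less_0_iff split: if_splits)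
    have "sgn (poly q ((c + d) / 2)) = sgn (poly q r)"
    proof (rule poly_sgn_constant)
      fix u assume "min ((c + d) / 2) r \<le> u" "u \<le> max ((c + d) / 2) r"
      then have "c < u" "u < d" using ac db by (auto simp: min_def max_def split: if_splits)
      then show "poly q u \<noteq> 0" using W(2)[of u] gap[of u] pos by (cases "q = 0") auto
    qed
    with pos have mid: "0 < poly q ((c + d) / 2)" by (metis sgn_greater)
    have ?gap
      using ac db cd mid gap by (intro bexI[of _ c] bexI[of _ d]) auto
    then show ?thesis ..
  qed
qed

text \<open>
  By the mean value theorem \<open>p(a)\<close> and \<open>p(b)\<close> are products of \<open>a - r < 0\<close> and \<open>b - r > 0\<close> with values of
  \<open>p'\<close> on \<open>(a, b)\<close>, and these values have the same sign because \<open>p'\<close> has no root there.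
\<close>

lemma root_in_critical_gap:
  fixes p :: "real poly"
  assumes r: "a < r" "r < b" "poly p r = 0"
    and no_crit: "\<And>t. a < t \<Longrightarrow> t < b \<Longrightarrow> poly (pderiv p) t \<noteq> 0"
  shows "poly p a * poly p b < 0"
proof -
  obtain c where c: "a < c" "c < r" "poly p r - poly p a = (r - a) * poly (pderiv p) c"
    using poly_MVT[OF r(1)] by blast
  obtain d where d: "r < d" "d < b" "poly p b - poly p r = (b - r) * poly (pderiv p) d"
    using poly_MVT[OF r(2)] by blast
  have "sgn (poly (pderiv p) c) = sgn (poly (pderiv p) d)"
    using c d by (intro poly_sgn_constant no_crit) auto
  moreover have "poly (pderiv p) d \<noteq> 0"
    using d r by (intro no_crit) auto
  ultimately have "0 < poly (pderiv p) c * poly (pderiv p) d"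
    by (auto simp: sgn_if zero_less_mult_iff split: if_splits)
  moreover have "poly p a = - ((r - a) * poly (pderiv p) c)" "poly p b = (b - r) * poly (pderiv p) d"
    using c(3) d(3) r(3) by simp_all
  then have "poly p a * poly p b =
      - ((r - a) * (b - r) * (poly (pderiv p) c * poly (pderiv p) d))"
    by simp
  ultimately show ?thesis using r by simp
qed

lemma root_unique_in_critical_gap:
  fixes p :: "real poly"
  assumes "a < r" "r < b" "poly p r = 0" "a < t" "t < b" "poly p t = 0"
    and no_crit: "\<And>t. a < t \<Longrightarrow> t < b \<Longrightarrow> poly (pderiv p) t \<noteq> 0"
  shows "t = r"
proof (rule ccontr)
  assume "t \<noteq> r"
  then have lt: "min t r < max t r" by auto
  obtain c where "min t r < c" "c < max t r"
    "poly p (max t r) - poly p (min t r) = (max t r - min t r) * poly (pderiv p) c"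
    using poly_MVT[OF lt] by blast
  moreover have "poly p (max t r) = 0" "poly p (min t r) = 0"
    using assms by (auto simp: min_def max_def)
  ultimately show False
    using no_crit[of c] assms lt by (auto simp: min_def max_def split: if_splits)
qed

text \<open>
  A form of Cauchy's root bound. The absolute values of the coefficients are replaced by the larger
  quantities \<open>1 + c\<^sup>2\<close> so that the bound is itself a polynomial in the coefficients.
\<close>

lemma monic_root_bound:
  fixes p :: "real poly"
  assumes deg: "degree p \<le> n" and monic: "coeff p n = 1" and root: "poly p t = 0"
  shows "\<bar>t\<bar> < 1 + (\<Sum>i<n. 1 + (coeff p i)\<^sup>2)"
proof (rule ccontr)
  assume ge: "\<not> ?thesis"
  let ?s = "\<Sum>i<n. 1 + (coeff p i)\<^sup>2"
  have s: "0 \<le> ?s" by (intro sum_nonneg) auto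
  then have t1: "1 \<le> \<bar>t\<bar>" "?s < \<bar>t\<bar>" using ge by auto
  have "poly p t = (\<Sum>i\<le>n. coeff p i * t ^ i)"
    unfolding poly_altdef using deg by (intro sum.mono_neutral_left) (auto intro: coeff_eq_0)
  also have "\<dots> = (\<Sum>i<n. coeff p i * t ^ i) + t ^ n"
    using monic by (simp flip: lessThan_Suc_atMost)
  finally have tn: "t ^ n = - (\<Sum>i<n. coeff p i * t ^ i)" using root by simp
  show False
  proof (cases n)
    case 0
    then show False using tn by simp
  next
    case (Suc m)
    have "\<bar>t\<bar> ^ n = \<bar>\<Sum>i<n. coeff p i * t ^ i\<bar>" using tn by (simp flip: power_abs)
    also have "\<dots> \<le> (\<Sum>i<n. (1 + (coeff p i)\<^sup>2) * \<bar>t\<bar> ^ m)"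
    proof (rule sum_abs[THEN order_trans], rule sum_mono)
      fix i assume i: "i \<in> {..<n}"
      have "\<bar>coeff p i\<bar> \<le> 1 + (coeff p i)\<^sup>2"
        using sum_squares_bound[of 1 "\<bar>coeff p i\<bar>"] by simp
      moreover have "\<bar>t\<bar> ^ i \<le> \<bar>t\<bar> ^ m"
        using i Suc t1 by (intro power_increasing) auto
      ultimately show "\<bar>coeff p i * t ^ i\<bar> \<le> (1 + (coeff p i)\<^sup>2) * \<bar>t\<bar> ^ m"
        by (simp add: abs_mult power_abs mult_mono)
    qed
    also have "\<dots> = ?s * \<bar>t\<bar> ^ m" by (simp add: sum_distrib_right)
    also have "\<dots> < \<bar>t\<bar> * \<bar>t\<bar> ^ m" using t1 by (intro mult_strict_right_mono) auto
    also have "\<dots> = \<bar>t\<bar> ^ n" using Suc by simp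
    finally show False by simp
  qed
qed

text \<open>
  One sample point in each of the regions into which a finite set \<open>W\<close> divides the line: its points, the
  midpoints of its gaps, and a point beyond each end; \<open>0\<close> serves for empty \<open>W\<close>. Midpoints of all pairs
  are included, so that the set of samples is given by formulas that do not depend on the order of the
  elements of \<open>W\<close> and therefore make sense for functions.
\<close>

lemma finite_set_sample:
  fixes W :: "real set"
  assumes "finite W"
  shows "\<exists>e \<in> insert 0 (W \<union> (\<lambda>w. w - 1) ` W \<union> (\<lambda>w. w + 1) ` W \<union> (\<lambda>(v, w). (v + w) / 2) ` (W \<times> W)).
    e = t \<or> (\<forall>w\<in>W. (w < e \<and> w < t) \<or> (e < w \<and> t < w))"
proof (cases "t \<in> W")
  case True
  then show ?thesis by (intro bexI[of _ t]) auto
next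
  case False
  let ?E = "insert 0 (W \<union> (\<lambda>w. w - 1) ` W \<union> (\<lambda>w. w + 1) ` W \<union> (\<lambda>(v, w). (v + w) / 2) ` (W \<times> W))"
  have side: "w < t \<or> t < w" if "w \<in> W" for w
    using that False by (cases w t rule: linorder_cases) auto
  have pick: ?thesis if "e \<in> ?E" "\<And>w. w \<in> W \<Longrightarrow> (w < e \<and> w < t) \<or> (e < w \<and> t < w)" for e
    by (rule bexI[OF _ that(1)], rule disjI2, rule ballI, rule that(2))
  have lower: "\<exists>l\<in>W. l < t \<and> (\<forall>w\<in>W. w < t \<longrightarrow> w \<le> l)" if "\<exists>w\<in>W. w < t"
  proof -
    have "finite {w\<in>W. w < t}" "{w\<in>W. w < t} \<noteq> {}" using assms that by auto
    from Max_in[OF this] Max_ge[OF this(1)] show ?thesis by blast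
  qed
  have upper: "\<exists>u\<in>W. t < u \<and> (\<forall>w\<in>W. t < w \<longrightarrow> u \<le> w)" if "\<exists>w\<in>W. t < w"
  proof -
    have "finite {w\<in>W. t < w}" "{w\<in>W. t < w} \<noteq> {}" using assms that by auto
    from Min_in[OF this] Min_le[OF this(1)] show ?thesis by blast
  qed
  show ?thesis
  proof (cases "\<exists>w\<in>W. w < t")
    case lt: True
    from lower[OF this] obtain l where l: "l \<in> W" "l < t" "\<And>w. w \<in> W \<Longrightarrow> w < t \<Longrightarrow> w \<le> l" by blast
    show ?thesis
    proof (cases "\<exists>w\<in>W. t < w")
      case True
      from upper[OF this] obtain u where u: "u \<in> W" "t < u" "\<And>w. w \<in> W \<Longrightarrow> t < w \<Longrightarrow> u \<le> w" by blast
      have "(w < (l + u) / 2 \<and> w < t) \<or> ((l + u) / 2 < w \<and> t < w)" if "w \<in> W" for w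
        using side[OF that] l(2) u(2) l(3)[OF that] u(3)[OF that] by auto
      moreover have "(l + u) / 2 \<in> ?E" using l(1) u(1) by auto
      ultimately show ?thesis by (rule pick[rotated])
    next
      case False
      have "(w < l + 1 \<and> w < t) \<or> (l + 1 < w \<and> t < w)" if "w \<in> W" for w
        using side[OF that] l(3)[OF that] False that by auto
      moreover have "l + 1 \<in> ?E" using l(1) by blast
      ultimately show ?thesis by (rule pick[rotated])
    qed
  next
    case lt: False
    show ?thesis
    proof (cases "\<exists>w\<in>W. t < w")
      case True
      from upper[OF this] obtain u where u: "u \<in> W" "t < u" "\<And>w. w \<in> W \<Longrightarrow> t < w \<Longrightarrow> u \<le> w" by blast
      have "(w < u - 1 \<and> w < t) \<or> (u - 1 < w \<and> t < w)" if "w \<in> W" for w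
        using side[OF that] u(3)[OF that] lt that by auto
      moreover have "u - 1 \<in> ?E" using u(1) by blast
      ultimately show ?thesis by (rule pick[rotated])
    next
      case False
      then have "W = {}" using lt side by blast
      then show ?thesis by (intro pick[of 0]) auto
    qed
  qed
qed

section \<open>Tracing roots in a maximal ring\<close>

context maximal_positivity_ring
begin

text \<open>
  The roots of a family of polynomials can be traced by finitely many members of \<open>R\<close>.
  Points where \<open>P\<close> degenerates to the zero polynomial are exempt, since there every real is a root.
\<close>

definition root_cover :: "('x \<Rightarrow> real) set \<Rightarrow> ('x \<Rightarrow> real poly) \<Rightarrow> bool"
  where "root_cover E P \<longleftrightarrow> finite E \<and> E \<subseteq> R \<and>
    (\<forall>x t. P x \<noteq> 0 \<longrightarrow> poly (P x) t = 0 \<longrightarrow> (\<exists>e\<in>E. e x = t))"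

text \<open>
  Division by a monic polynomial needs no division of coefficients, so it can be carried out over \<open>R\<close>
  at all points simultaneously; at roots of \<open>P\<close> the remainder takes the same value as \<open>Q\<close>.
\<close>

lemma monic_reduction:
  assumes P: "poly_family n P" "\<And>x. coeff (P x) n = 1" and n: "1 \<le> n" and Q: "poly_family m Q"
  shows "\<exists>T. poly_family (n - 1) T \<and> (\<forall>x t. poly (P x) t = 0 \<longrightarrow> poly (T x) t = poly (Q x) t)"
  using Q
proof (induction m arbitrary: Q)
  case 0
  then have "poly_family (n - 1) Q" by (rule poly_family_mono) simp
  then show ?case by blast
next
  case (Suc m)
  show ?case
  proof (cases "Suc m < n")
    case True
    then have "poly_family (n - 1) Q" by (intro poly_family_mono[OF Suc.prems]) simp
    then show ?thesis by blast
  next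
    case False
    define Q' where "Q' x = Q x - monom (coeff (Q x) (Suc m)) (Suc m - n) * P x" for x
    have "poly_family m Q'"
    proof (rule poly_familyI)
      show "(\<lambda>x. coeff (Q' x) i) \<in> R" for i
        unfolding Q'_def coeff_diff coeff_monom_mult
        using Suc.prems P(1)
        by (cases "i < Suc m - n") (auto intro!: diff_mem mult_mem poly_family_coeff const_mem)
      fix i x assume "m < i"
      then consider "i = Suc m" | "Suc m < i" by linarith
      then show "coeff (Q' x) i = 0"
      proof cases
        case 1
        then show ?thesis using False P(2) by (auto simp: Q'_def coeff_monom_mult)
      next
        case 2
        then have "n < i - (Suc m - n)" using False by simp
        then show ?thesis
          using 2 poly_family_coeff_0[OF Suc.prems 2] poly_family_coeff_0[OF P(1)]
          by (auto simp: Q'_def coeff_monom_mult)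
      qed
    qed
    from Suc.IH[OF this] obtain T where "poly_family (n - 1) T"
      and "\<And>x t. poly (P x) t = 0 \<Longrightarrow> poly (T x) t = poly (Q' x) t" by blast
    then show ?thesis by (auto simp: Q'_def)
  qed
qed

text \<open>
  At a point where \<open>Q\<close> has degree exactly \<open>k\<close> it can be divided by its coefficient of degree \<open>k\<close>. The
  resulting polynomial \<open>M k\<close> is monic at all points, also at those where it is unrelated to \<open>Q\<close>, and
  the roots of \<open>M 0, \<dots>, M n\<close> together include those of \<open>Q\<close> wherever \<open>Q\<close> is nonzero.
\<close>

lemma root_cover_of_monic:
  assumes monic: "\<And>k P. k \<le> n \<Longrightarrow> poly_family k P \<Longrightarrow> (\<And>x. coeff (P x) k = 1) \<Longrightarrow> \<exists>E. root_cover E P"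
    and Q: "poly_family n Q"
  shows "\<exists>E. root_cover E Q"
proof -
  define M where "M k x =
    (\<Sum>i\<le>k. monom (if i = k then 1 else coeff (Q x) i * inverse (coeff (Q x) k)) i)" for k x
  have coeff_M: "coeff (M k x) i =
      (if i < k then coeff (Q x) i * inverse (coeff (Q x) k) else if i = k then 1 else 0)" for k x i
    by (auto simp: M_def coeff_sum)
  have "poly_family k (M k)" for k
  proof (rule poly_familyI)
    show "(\<lambda>x. coeff (M k x) i) \<in> R" for i
      by (cases i k rule: linorder_cases)
        (auto simp: coeff_M intro!: mult_mem inverse_mem const_mem poly_family_coeff[OF Q])
  qed (auto simp: coeff_M)
  then have "\<exists>E. root_cover E (M k)" if "k \<le> n" for k
    using that by (intro monic) (auto simp: coeff_M)
  then obtain E where E: "\<And>k. k \<le> n \<Longrightarrow> root_cover (E k) (M k)" by metis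
  have "root_cover (\<Union>k\<le>n. E k) Q"
    unfolding root_cover_def
  proof (intro conjI allI impI)
    show "finite (\<Union>k\<le>n. E k)" "(\<Union>k\<le>n. E k) \<subseteq> R"
      using E by (auto simp: root_cover_def)
    fix x t assume Q0: "Q x \<noteq> 0" and t: "poly (Q x) t = 0"
    define k where "k = degree (Q x)"
    have lc: "coeff (Q x) k \<noteq> 0" using Q0 by (simp add: k_def)
    have "k \<le> n" using poly_family_degree[OF Q] by (simp add: k_def)
    have "M k x = smult (inverse (coeff (Q x) k)) (Q x)"
      using lc by (auto simp: poly_eq_iff coeff_M k_def coeff_eq_0)
    then have "M k x \<noteq> 0" "poly (M k x) t = 0" using lc t Q0 by auto
    then show "\<exists>e\<in>\<Union>k\<le>n. E k. e x = t"
      using E[OF \<open>k \<le> n\<close>] \<open>k \<le> n\<close> by (fastforce simp: root_cover_def)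
  qed
  then show ?thesis ..
qed

text \<open>
  A root \<open>\<xi>\<close> of \<open>P\<close> isolated by \<open>a\<close> and \<open>b\<close> is effective: the sign of \<open>Q(\<xi>)\<close> is that of a reduced
  polynomial \<open>T(\<xi>)\<close> whose own roots are already traced by members of \<open>R\<close>, and it is therefore
  given by sign conditions on members of \<open>R\<close> alone. Outside the domain \<open>C\<close> of the root, \<open>\<xi>\<close> takes
  the default value \<open>0\<close>.
\<close>

lemma isolated_root_mem:
  assumes P: "poly_family n P" and a: "a \<in> R" and b: "b \<in> R" and C: "{x. C x} \<in> B"
    and root: "\<And>x. C x \<Longrightarrow> a x < \<xi> x \<and> \<xi> x < b x \<and> poly (P x) (\<xi> x) = 0"
    and change: "\<And>x. C x \<Longrightarrow> poly (P x) (a x) * poly (P x) (b x) < 0"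
    and unique: "\<And>x t. C x \<Longrightarrow> a x < t \<Longrightarrow> t < b x \<Longrightarrow> poly (P x) t = 0 \<Longrightarrow> t = \<xi> x"
    and default: "\<And>x. \<not> C x \<Longrightarrow> \<xi> x = 0"
    and reduce: "\<And>m Q. poly_family m Q \<Longrightarrow> \<exists>k T W. poly_family k T \<and> root_cover W T \<and>
      (\<forall>x. C x \<longrightarrow> poly (T x) (\<xi> x) = poly (Q x) (\<xi> x))"
  shows "\<xi> \<in> R"
proof (rule effective_mem)
  fix m Q assume Q: "poly_family m Q"
  from reduce[OF this] obtain k T W where T: "poly_family k T" and W: "root_cover W T"
    and TQ: "\<And>x. C x \<Longrightarrow> poly (T x) (\<xi> x) = poly (Q x) (\<xi> x)" by blast
  have finW: "finite W" and WR: "\<And>w. w \<in> W \<Longrightarrow> w \<in> R"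
    and roots: "\<And>x t. T x \<noteq> 0 \<Longrightarrow> poly (T x) t = 0 \<Longrightarrow> t \<in> (\<lambda>w. w x) ` W"
    using W unfolding root_cover_def by (blast, blast, blast)
  let ?V = "insert a (insert b W)" and ?W = "\<lambda>x. (\<lambda>w. w x) ` W"
  have VR: "v \<in> R" if "v \<in> ?V" for v using that a b WR by auto
  have eq: "0 < poly (Q x) (\<xi> x) \<longleftrightarrow>
    (\<not> C x \<and> 0 < poly (Q x) 0) \<or>
    (C x \<and> ((\<exists>w\<in>W. (a x < w x \<and> w x < b x) \<and> poly (P x) (w x) = 0 \<and> 0 < poly (T x) (w x)) \<or>
      (\<exists>c\<in>?V. \<exists>d\<in>?V. (a x \<le> c x \<and> c x < d x \<and> d x \<le> b x) \<and>
        poly (P x) (c x) * poly (P x) (d x) < 0 \<and> (\<forall>w\<in>W. \<not> (c x < w x \<and> w x < d x)) \<and>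
        0 < poly (T x) ((c x + d x) / 2))))" for x
  proof (cases "C x")
    case True
    from root[OF this] have r: "a x < \<xi> x" "\<xi> x < b x" "poly (P x) (\<xi> x) = 0" by auto
    have "0 < poly (Q x) (\<xi> x) \<longleftrightarrow> 0 < poly (T x) (\<xi> x)"
      using TQ[OF True] by simp
    also have "\<dots> \<longleftrightarrow>
      (\<exists>w\<in>?W x. (a x < w \<and> w < b x) \<and> poly (P x) w = 0 \<and> 0 < poly (T x) w) \<or>
      (\<exists>c\<in>insert (a x) (insert (b x) (?W x)). \<exists>d\<in>insert (a x) (insert (b x) (?W x)).
        (a x \<le> c \<and> c < d \<and> d \<le> b x) \<and> poly (P x) c * poly (P x) d < 0 \<and>
        (\<forall>w\<in>?W x. \<not> (c < w \<and> w < d)) \<and> 0 < poly (T x) ((c + d) / 2))"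
      using unique[OF True] roots[of x]
      by (intro sign_at_isolated_root[OF r _ change[OF True]] finite_imageI[OF finW])
    finally show ?thesis using True by simp
  next
    case False
    then show ?thesis using default by simp
  qed
  have mid: "(\<lambda>x. (c x + d x) / 2) \<in> R" if "c \<in> R" "d \<in> R" for c d
    using mult_mem[OF const_mem[of "1/2"] add_mem[OF that]] by simp
  have default_B: "{x. \<not> C x \<and> 0 < poly (Q x) 0} \<in> B"
    by (rule B_conj[OF B_not[OF C] pos_mem[OF eval_mem[OF Q const_mem]]])
  have root_B: "{x. (a x < w x \<and> w x < b x) \<and> poly (P x) (w x) = 0 \<and> 0 < poly (T x) (w x)} \<in> B"
    if "w \<in> R" for w
    by (rule B_conj[OF B_conj[OF B_less[OF a that] B_less[OF that b]]
          B_conj[OF B_eq[OF eval_mem[OF P that] const_mem] pos_mem[OF eval_mem[OF T that]]]])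
  have gap_B: "{x. (a x \<le> c x \<and> c x < d x \<and> d x \<le> b x) \<and>
      poly (P x) (c x) * poly (P x) (d x) < 0 \<and> (\<forall>w\<in>W. \<not> (c x < w x \<and> w x < d x)) \<and>
      0 < poly (T x) ((c x + d x) / 2)} \<in> B" if c: "c \<in> R" and d: "d \<in> R" for c d
  proof (intro B_conj)
    show "{x. a x \<le> c x} \<in> B" "{x. c x < d x} \<in> B" "{x. d x \<le> b x} \<in> B"
      using a b c d by (simp_all add: B_le B_less)
    show "{x. poly (P x) (c x) * poly (P x) (d x) < 0} \<in> B"
      by (rule B_less[OF mult_mem[OF eval_mem[OF P c] eval_mem[OF P d]] const_mem])
    show "{x. \<forall>w\<in>W. \<not> (c x < w x \<and> w x < d x)} \<in> B"
      using c d WR by (intro B_ball[OF finW] B_not B_conj B_less) auto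
    show "{x. 0 < poly (T x) ((c x + d x) / 2)} \<in> B"
      by (rule pos_mem[OF eval_mem[OF T mid[OF c d]]])
  qed
  show "{x. 0 < poly (Q x) (\<xi> x)} \<in> B"
    unfolding eq
    by (rule B_disj[OF default_B B_conj[OF C B_disj[OF B_bex[OF finW root_B[OF WR]]
          B_bex[OF _ B_bex[OF _ gap_B[OF VR VR]]]]]])
      (use finW in simp_all)
qed

text \<open>
  Induction on the degree. The derivative has degree \<open>n - 1\<close>, so its roots are traced by a finite set
  \<open>Z\<close> in \<open>R\<close>; together with a bound \<open>\<plusminus>M\<close> for the roots of \<open>P\<close> they cut out intervals on which \<open>P\<close> is
  monotone. The root in such an interval, if there is one, is isolated, and by division with remainder
  \<open>Q(\<xi>)\<close> reduces to a polynomial of degree below \<open>n\<close>, to which the induction hypothesis applies.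
\<close>

lemma monic_root_cover:
  assumes "poly_family n P" and "\<And>x. coeff (P x) n = 1"
  shows "\<exists>E. root_cover E P"
  using assms
proof (induction n arbitrary: P rule: less_induct)
  case (less n)
  note P = less.prems
  show ?case
  proof (cases "n = 0")
    case True
    have "poly (P x) t = 1" for x t
      using P True by (simp add: poly_family_poly_eq)
    then have "root_cover {} P" by (simp add: root_cover_def)
    then show ?thesis ..
  next
    case False
    then have n: "1 \<le> n" by simp
    have lower: "\<exists>E. root_cover E T" if "poly_family (n - 1) T" for T
    proof (rule root_cover_of_monic[OF _ that])
      fix k P assume "k \<le> n - 1" "poly_family k P" "\<And>x. coeff (P x) k = 1"
      with n show "\<exists>E. root_cover E P" by (intro less.IH[of k]) simp_all
    qed
    have "poly_family (n - 1) (\<lambda>x. pderiv (P x))"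
      by (rule poly_familyI)
        (use n poly_family_coeff_0[OF P(1)] in \<open>auto simp: coeff_pderiv simp del: of_nat_Suc
          intro!: mult_mem const_mem poly_family_coeff[OF P(1)]\<close>)
    from lower[OF this] obtain Z where Z: "root_cover Z (\<lambda>x. pderiv (P x))" ..
    have finZ: "finite Z" and ZR: "\<And>z. z \<in> Z \<Longrightarrow> z \<in> R"
      using Z by (auto simp: root_cover_def)
    have "pderiv (P x) \<noteq> 0" for x
    proof -
      have "coeff (pderiv (P x)) (n - 1) = real n"
        using n P(2) by (simp add: coeff_pderiv)
      then show ?thesis using n by auto
    qed
    then have crit: "\<exists>z\<in>Z. z x = t" if "poly (pderiv (P x)) t = 0" for x t
      using Z that by (auto simp: root_cover_def)
    define M where "M x = 1 + (\<Sum>i<n. 1 + (coeff (P x) i)\<^sup>2)" for x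
    have MR: "M \<in> R"
      unfolding M_def[abs_def] by (intro add_mem sum_mem power_mem const_mem poly_family_coeff[OF P(1)])
    have MR': "(\<lambda>x. - M x) \<in> R" by (rule uminus_mem[OF MR])
    define V where "V = insert M (insert (\<lambda>x. - M x) Z)"
    have finV: "finite V" and VR: "\<And>v. v \<in> V \<Longrightarrow> v \<in> R"
      using finZ ZR MR MR' by (auto simp: V_def)
    \<comment> \<open>Which members of \<open>V\<close> are consecutive depends on \<open>x\<close>, so every pair gets its own root function,
      set to \<open>0\<close> where the pair does not isolate a root.\<close>
    define C where "C a b x \<longleftrightarrow> a x < b x \<and> poly (P x) (a x) * poly (P x) (b x) < 0 \<and>
      (\<forall>z\<in>Z. \<not> (a x < z x \<and> z x < b x))" for a b x
    define \<xi> where "\<xi> a b x = (if C a b x then SOME t. a x < t \<and> t < b x \<and> poly (P x) t = 0 else 0)"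
      for a b x
    have \<xi>: "a x < \<xi> a b x \<and> \<xi> a b x < b x \<and> poly (P x) (\<xi> a b x) = 0" if "C a b x" for a b x
    proof -
      have "\<exists>t. a x < t \<and> t < b x \<and> poly (P x) t = 0"
        using that by (intro poly_root_between) (auto simp: C_def)
      from someI_ex[OF this] show ?thesis using that by (simp add: \<xi>_def)
    qed
    have unique: "t = \<xi> a b x" if "C a b x" "a x < t" "t < b x" "poly (P x) t = 0" for a b x t
    proof (rule root_unique_in_critical_gap[of "a x" _ "b x" "P x"])
      show "poly (pderiv (P x)) u \<noteq> 0" if "a x < u" "u < b x" for u
        using crit[of x u] that \<open>C a b x\<close> by (auto simp: C_def)
    qed (use \<xi>[OF that(1)] that in auto)
    have \<xi>R: "\<xi> a b \<in> R" if ab: "a \<in> V" "b \<in> V" for a b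
    proof (rule isolated_root_mem[where C = "C a b" and \<xi> = "\<xi> a b", OF P(1) VR[OF ab(1)] VR[OF ab(2)]])
      show "{x. C a b x} \<in> B"
        unfolding C_def
        by (rule B_conj[OF B_less[OF VR VR] B_conj[OF B_less[OF mult_mem[OF eval_mem eval_mem] const_mem]
              B_ball[OF finZ B_not[OF B_conj[OF B_less[OF VR ZR] B_less[OF ZR VR]]]]]])
          (use ab P(1) VR in auto)
      show "\<exists>k T W. poly_family k T \<and> root_cover W T \<and>
          (\<forall>x. C a b x \<longrightarrow> poly (T x) (\<xi> a b x) = poly (Q x) (\<xi> a b x))" if "poly_family m Q" for m Q
      proof -
        from monic_reduction[OF P n that] obtain T where "poly_family (n - 1) T"
          "\<And>x t. poly (P x) t = 0 \<Longrightarrow> poly (T x) t = poly (Q x) t" by blast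
        with lower[of T] \<xi> show ?thesis by blast
      qed
    qed (use \<xi> unique in \<open>auto simp: C_def \<xi>_def\<close>)
    have "root_cover (Z \<union> (\<lambda>(a, b). \<xi> a b) ` (V \<times> V)) P"
      unfolding root_cover_def
    proof (intro conjI allI impI)
      show "finite (Z \<union> (\<lambda>(a, b). \<xi> a b) ` (V \<times> V))" using finZ finV by auto
      show "Z \<union> (\<lambda>(a, b). \<xi> a b) ` (V \<times> V) \<subseteq> R" using ZR \<xi>R by auto
      fix x t assume t: "poly (P x) t = 0"
      show "\<exists>e\<in>Z \<union> (\<lambda>(a, b). \<xi> a b) ` (V \<times> V). e x = t"
      proof (cases "\<exists>z\<in>Z. z x = t")
        case True
        then show ?thesis by blast
      next
        case False
        have bound: "- M x < t" "t < M x"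
          using monic_root_bound[OF poly_family_degree[OF P(1)] P(2) t] by (auto simp: M_def)
        let ?L = "{s\<in>(\<lambda>v. v x) ` V. s < t}" and ?U = "{s\<in>(\<lambda>v. v x) ` V. t < s}"
        have L: "finite ?L" "?L \<noteq> {}" and U: "finite ?U" "?U \<noteq> {}"
          using finV bound by (auto simp: V_def)
        obtain a where a: "a \<in> V" "a x < t" "\<And>v. v \<in> V \<Longrightarrow> v x < t \<Longrightarrow> v x \<le> a x"
          using Max_in[OF L] Max_ge[OF L(1)] by auto
        obtain b where b: "b \<in> V" "t < b x" "\<And>v. v \<in> V \<Longrightarrow> t < v x \<Longrightarrow> b x \<le> v x"
          using Min_in[OF U] Min_le[OF U(1)] by auto
        have gap: "\<not> (a x < z x \<and> z x < b x)" if "z \<in> Z" for z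
          using a(3)[of z] b(3)[of z] that False by (cases "z x" t rule: linorder_cases) (auto simp: V_def)
        have "poly (P x) (a x) * poly (P x) (b x) < 0"
          using a(2) b(2) t crit gap by (intro root_in_critical_gap[of "a x" t]) blast+
        then have "C a b x" using a(2) b(2) gap by (auto simp: C_def)
        from unique[OF this a(2) b(2) t] show ?thesis using a(1) b(1) by auto
      qed
    qed
    then show ?thesis ..
  qed
qed

lemma ex_root_cover: "poly_family n Q \<Longrightarrow> \<exists>E. root_cover E Q"
  by (rule root_cover_of_monic[OF monic_root_cover])

text \<open>
  Finitely many members of \<open>R\<close> meet, over every point, every sign pattern that the polynomials in \<open>F\<close>
  attain on the line. This turns the quantifier \<open>\<exists>t\<close> into a finite disjunction.
\<close>

lemma ex_sign_sample:
  assumes F: "finite F" "\<forall>Q\<in>F. \<exists>n. poly_family n Q"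
  shows "\<exists>E. finite E \<and> E \<subseteq> R \<and>
    (\<forall>x t. \<exists>e\<in>E. \<forall>Q\<in>F. sgn (poly (Q x) (e x)) = sgn (poly (Q x) t))"
proof -
  have "\<forall>Q\<in>F. \<exists>E. root_cover E Q" using F(2) ex_root_cover by blast
  then obtain W where W: "\<And>Q. Q \<in> F \<Longrightarrow> root_cover (W Q) Q" by metis
  define V where "V = (\<Union>Q\<in>F. W Q)"
  have finV: "finite V" and VR: "\<And>v. v \<in> V \<Longrightarrow> v \<in> R"
    using W F(1) by (auto simp: V_def root_cover_def)
  define E where "E = insert (\<lambda>x. 0) (V \<union> (\<lambda>w x. w x - 1) ` V \<union> (\<lambda>w x. w x + 1) ` V \<union>
    (\<lambda>(v, w) x. (v x + w x) / 2) ` (V \<times> V))"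
  have "finite E" using finV by (auto simp: E_def)
  moreover have "E \<subseteq> R"
  proof -
    have "(\<lambda>x. (v x + w x) / 2) \<in> R" if "v \<in> V" "w \<in> V" for v w
      using mult_mem[OF const_mem[of "1/2"] add_mem[OF VR[OF that(1)] VR[OF that(2)]]] by simp
    then show ?thesis
      by (auto simp: E_def intro: VR intro!: const_mem diff_mem add_mem)
  qed
  moreover have "\<exists>e\<in>E. \<forall>Q\<in>F. sgn (poly (Q x) (e x)) = sgn (poly (Q x) t)" for x t
  proof -
    let ?W = "(\<lambda>v. v x) ` V"
    obtain s where s: "s \<in> insert 0 (?W \<union> (\<lambda>w. w - 1) ` ?W \<union> (\<lambda>w. w + 1) ` ?W \<union>
        (\<lambda>(v, w). (v + w) / 2) ` (?W \<times> ?W))"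
      and sep: "s = t \<or> (\<forall>w\<in>?W. (w < s \<and> w < t) \<or> (s < w \<and> t < w))"
      using finite_set_sample[OF finite_imageI[OF finV, of "\<lambda>v. v x"], of t] by (elim bexE) (rule that)
    from s consider "s = 0" | v where "v \<in> V" "s = v x" | v where "v \<in> V" "s = v x - 1"
      | v where "v \<in> V" "s = v x + 1" | v w where "v \<in> V" "w \<in> V" "s = (v x + w x) / 2"
      by auto
    then have "\<exists>e\<in>E. e x = s"
    proof cases
      case 1
      then show ?thesis by (intro bexI[of _ "\<lambda>x. 0"]) (auto simp: E_def)
    next
      case (2 v)
      then show ?thesis by (intro bexI[of _ v]) (auto simp: E_def)
    next
      case (3 v)
      then show ?thesis by (intro bexI[of _ "\<lambda>x. v x - 1"]) (auto simp: E_def)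
    next
      case (4 v)
      then show ?thesis by (intro bexI[of _ "\<lambda>x. v x + 1"]) (auto simp: E_def)
    next
      case (5 v w)
      then show ?thesis by (intro bexI[of _ "\<lambda>x. (v x + w x) / 2"]) (auto simp: E_def)
    qed
    then obtain e where e: "e \<in> E" and es: "e x = s" by blast
    with sep have sep: "e x = t \<or> (\<forall>w\<in>V. (w x < e x \<and> w x < t) \<or> (e x < w x \<and> t < w x))" by simp
    have "sgn (poly (Q x) (e x)) = sgn (poly (Q x) t)" if Q: "Q \<in> F" for Q
    proof (cases "e x = t \<or> Q x = 0")
      case False
      show ?thesis
      proof (rule poly_sgn_constant, rule notI)
        fix u assume u: "min (e x) t \<le> u" "u \<le> max (e x) t" "poly (Q x) u = 0"
        then obtain w where "w \<in> V" "w x = u"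
          using W[OF Q] False Q by (force simp: root_cover_def V_def)
        then show False using sep False u by (auto simp: min_def max_def split: if_splits)
      qed
    qed auto
    with e show ?thesis by blast
  qed
  ultimately show ?thesis by blast
qed

end

section \<open>Semialgebraic sets and the Tarski--Seidenberg theorem\<close>

lemma coord_space_upd: "x \<in> coord_space I \<Longrightarrow> x(j := t) \<in> coord_space (insert j I)"
  by (rule PiE_fun_upd) auto

lemma polynomial_fun_on_sum:
  "(\<And>a. a \<in> A \<Longrightarrow> polynomial_fun_on I (p a)) \<Longrightarrow> polynomial_fun_on I (\<lambda>x. \<Sum>a\<in>A. p a x)"
  by (induction A rule: infinite_finite_induct)
    (simp_all add: polynomial_fun_on.const polynomial_fun_on.add)

lemma polynomial_fun_on_prod:
  "(\<And>a. a \<in> A \<Longrightarrow> polynomial_fun_on I (p a)) \<Longrightarrow> polynomial_fun_on I (\<lambda>x. \<Prod>a\<in>A. p a x)"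
  by (induction A rule: infinite_finite_induct)
    (simp_all add: polynomial_fun_on.const polynomial_fun_on.mult)

lemma polynomial_fun_on_diff:
  "polynomial_fun_on I p \<Longrightarrow> polynomial_fun_on I q \<Longrightarrow> polynomial_fun_on I (\<lambda>x. p x - q x)"
  using polynomial_fun_on.add[OF _ polynomial_fun_on.mult[OF polynomial_fun_on.const[of I "-1"]]]
  by simp

lemma semialgebraic_le:
  assumes "polynomial_fun_on I p" "polynomial_fun_on I q"
  shows "semialgebraic I {x \<in> coord_space I. p x \<le> q x}"
proof -
  have "{x \<in> coord_space I. p x \<le> q x} = coord_space I - {x \<in> coord_space I. 0 < p x - q x}"
    by auto
  also have "semialgebraic I \<dots>"
    by (intro semialgebraic.compl semialgebraic.positive polynomial_fun_on_diff assms)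
  finally show ?thesis .
qed

lemma semialgebraic_eq:
  assumes "polynomial_fun_on I p" "polynomial_fun_on I q"
  shows "semialgebraic I {x \<in> coord_space I. p x = q x}"
proof -
  have "{x \<in> coord_space I. p x = q x} =
      {x \<in> coord_space I. p x \<le> q x} \<inter> {x \<in> coord_space I. q x \<le> p x}"
    by auto
  then show ?thesis
    by (simp add: semialgebraic.inter semialgebraic_le assms)
qed

lemma semialgebraic_space: "semialgebraic I (coord_space I)"
  using semialgebraic.positive[OF polynomial_fun_on.const[of I 1]] by simp

lemma semialgebraic_ball:
  assumes "finite A" and "\<And>a. a \<in> A \<Longrightarrow> semialgebraic I {x \<in> coord_space I. P a x}"
  shows "semialgebraic I {x \<in> coord_space I. \<forall>a\<in>A. P a x}"
  using assms
proof (induction A rule: finite_induct)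
  case empty
  then show ?case by (simp add: semialgebraic_space)
next
  case (insert a A)
  have "{x \<in> coord_space I. \<forall>b\<in>insert a A. P b x} =
      {x \<in> coord_space I. P a x} \<inter> {x \<in> coord_space I. \<forall>b\<in>A. P b x}"
    by auto
  then show ?case using insert by (simp add: semialgebraic.inter)
qed

text \<open>
  Semialgebraic sets live in a coordinate space, whereas the rings above consist of functions on a
  whole type; the values of these functions off the coordinate space are disregarded.
\<close>

definition semialgebraic_algebra :: "'i set \<Rightarrow> ('i \<Rightarrow> real) set set"
  where "semialgebraic_algebra I = {A. semialgebraic I (A \<inter> coord_space I)}"

lemma polynomials_positivity_ring:
  "positivity_ring (semialgebraic_algebra I) {p. polynomial_fun_on I p}"
proof
  show "- A \<in> semialgebraic_algebra I" if "A \<in> semialgebraic_algebra I" for A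
  proof -
    have "- A \<inter> coord_space I = coord_space I - A \<inter> coord_space I" by auto
    with that show ?thesis by (simp add: semialgebraic_algebra_def semialgebraic.compl)
  qed
  show "A \<inter> A' \<in> semialgebraic_algebra I"
    if "A \<in> semialgebraic_algebra I" "A' \<in> semialgebraic_algebra I" for A A'
  proof -
    have "A \<inter> A' \<inter> coord_space I = (A \<inter> coord_space I) \<inter> (A' \<inter> coord_space I)" by auto
    with that show ?thesis by (simp add: semialgebraic_algebra_def semialgebraic.inter)
  qed
  show "{x. 0 < p x} \<in> semialgebraic_algebra I" if "p \<in> {p. polynomial_fun_on I p}" for p
  proof -
    have "{x. 0 < p x} \<inter> coord_space I = {x \<in> coord_space I. 0 < p x}" by auto
    with that show ?thesis by (simp add: semialgebraic_algebra_def semialgebraic.positive)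
  qed
qed (simp_all add: polynomial_fun_on.intros)

text \<open>
  A maximal ring as above that contains the polynomial functions on \<open>\<real>\<^sup>I\<close>. Its members are functions with
  semialgebraic positivity sets.
\<close>

locale semialgebraic_extension = maximal_positivity_ring "semialgebraic_algebra I" R
  for I :: "'i set" and R :: "(('i \<Rightarrow> real) \<Rightarrow> real) set" +
  assumes polynomial_mem: "polynomial_fun_on I p \<Longrightarrow> p \<in> R"
begin

text \<open>
  A polynomial in the variables \<open>I\<close> and \<open>j\<close> is a polynomial in the variable \<open>j\<close> whose coefficients are
  polynomials in the variables \<open>I\<close>.
\<close>

lemma polynomial_fun_as_poly_family:
  assumes "polynomial_fun_on (insert j I) p"
  shows "\<exists>n Q. poly_family n Q \<and> (\<forall>x t. p (x(j := t)) = poly (Q x) t)"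
  using assms
proof induction
  case (const c)
  show ?case using poly_family_const[OF const_mem[of c]] by fastforce
next
  case (coord i)
  show ?case
  proof (cases "i = j")
    case True
    with poly_family_var show ?thesis by fastforce
  next
    case False
    then have "(\<lambda>x. x i) \<in> R" using coord by (auto intro: polynomial_mem polynomial_fun_on.coord)
    from poly_family_const[OF this] False show ?thesis by fastforce
  qed
next
  case (add p q)
  then obtain n P m Q where P: "poly_family n P" "\<And>x t. p (x(j := t)) = poly (P x) t"
    and Q: "poly_family m Q" "\<And>x t. q (x(j := t)) = poly (Q x) t" by blast
  from poly_family_add[OF P(1) Q(1)] P(2) Q(2) show ?case
    by (intro exI[of _ "max n m"] exI[of _ "\<lambda>x. P x + Q x"]) (simp del: fun_upd_apply)
next
  case (mult p q)
  then obtain n P m Q where P: "poly_family n P" "\<And>x t. p (x(j := t)) = poly (P x) t"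
    and Q: "poly_family m Q" "\<And>x t. q (x(j := t)) = poly (Q x) t" by blast
  from poly_family_mult[OF P(1) Q(1)] P(2) Q(2) show ?case
    by (intro exI[of _ "n + m"] exI[of _ "\<lambda>x. P x * Q x"]) (simp del: fun_upd_apply)
qed

text \<open>
  On each vertical line, membership in \<open>A\<close> depends only on the signs of the polynomials in \<open>F\<close>.
\<close>

definition signs_determine :: "'i \<Rightarrow> (('i \<Rightarrow> real) \<Rightarrow> real poly) set \<Rightarrow> ('i \<Rightarrow> real) set \<Rightarrow> bool"
  where "signs_determine j F A \<longleftrightarrow> (\<forall>x\<in>coord_space I. \<forall>s t.
    (\<forall>Q\<in>F. sgn (poly (Q x) s) = sgn (poly (Q x) t)) \<longrightarrow> (x(j := s) \<in> A \<longleftrightarrow> x(j := t) \<in> A))"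

lemma signs_determineD:
  assumes "signs_determine j F A" and "x \<in> coord_space I"
    and "\<And>Q. Q \<in> F \<Longrightarrow> sgn (poly (Q x) s) = sgn (poly (Q x) t)"
  shows "x(j := s) \<in> A \<longleftrightarrow> x(j := t) \<in> A"
  using assms unfolding signs_determine_def by blast

lemma signs_determine_combine:
  assumes A: "signs_determine j F A" and B: "signs_determine j G B"
    and C: "\<And>y. y \<in> C \<longleftrightarrow> f (y \<in> A) (y \<in> B)"
  shows "signs_determine j (F \<union> G) C"
  unfolding signs_determine_def
proof (intro ballI allI impI)
  fix x s t
  assume x: "x \<in> coord_space I" and eq: "\<forall>Q\<in>F \<union> G. sgn (poly (Q x) s) = sgn (poly (Q x) t)"
  have "x(j := s) \<in> A \<longleftrightarrow> x(j := t) \<in> A" by (rule signs_determineD[OF A x]) (use eq in blast)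
  moreover have "x(j := s) \<in> B \<longleftrightarrow> x(j := t) \<in> B" by (rule signs_determineD[OF B x]) (use eq in blast)
  ultimately show "x(j := s) \<in> C \<longleftrightarrow> x(j := t) \<in> C" by (simp only: C)
qed

lemma ex_signs_determine:
  assumes "semialgebraic (insert j I) A"
  shows "\<exists>F. finite F \<and> (\<forall>Q\<in>F. \<exists>n. poly_family n Q) \<and> signs_determine j F A"
  using assms
proof induction
  case (positive p)
  then obtain n Q where Q: "poly_family n Q" and pQ: "\<And>x t. p (x(j := t)) = poly (Q x) t"
    using polynomial_fun_as_poly_family by blast
  have "signs_determine j {Q} {x \<in> coord_space (insert j I). 0 < p x}"
    unfolding signs_determine_def
  proof (intro ballI allI impI)
    fix x s t
    assume x: "x \<in> coord_space I" and "\<forall>Q\<in>{Q}. sgn (poly (Q x) s) = sgn (poly (Q x) t)"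
    then have "0 < poly (Q x) s \<longleftrightarrow> 0 < poly (Q x) t" by (metis sgn_greater singletonI)
    then show "x(j := s) \<in> {x \<in> coord_space (insert j I). 0 < p x} \<longleftrightarrow>
        x(j := t) \<in> {x \<in> coord_space (insert j I). 0 < p x}"
      using coord_space_upd[OF x] by (simp add: pQ del: fun_upd_apply)
  qed
  with Q show ?case by (intro exI[of _ "{Q}"]) auto
next
  case (union A B)
  then obtain F G where "finite F" "finite G" "\<forall>Q\<in>F \<union> G. \<exists>n. poly_family n Q"
    and A: "signs_determine j F A" and B: "signs_determine j G B" by blast
  have "signs_determine j (F \<union> G) (A \<union> B)"
    by (rule signs_determine_combine[where f = "(\<or>)", OF A B]) simp
  with \<open>finite F\<close> \<open>finite G\<close> \<open>\<forall>Q\<in>F \<union> G. \<exists>n. poly_family n Q\<close> show ?case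
    by (intro exI[of _ "F \<union> G"]) simp
next
  case (inter A B)
  then obtain F G where "finite F" "finite G" "\<forall>Q\<in>F \<union> G. \<exists>n. poly_family n Q"
    and A: "signs_determine j F A" and B: "signs_determine j G B" by blast
  have "signs_determine j (F \<union> G) (A \<inter> B)"
    by (rule signs_determine_combine[where f = "(\<and>)", OF A B]) simp
  with \<open>finite F\<close> \<open>finite G\<close> \<open>\<forall>Q\<in>F \<union> G. \<exists>n. poly_family n Q\<close> show ?case
    by (intro exI[of _ "F \<union> G"]) simp
next
  case (compl A)
  then obtain F where F: "finite F" "\<forall>Q\<in>F. \<exists>n. poly_family n Q" and A: "signs_determine j F A" by blast
  have "signs_determine j F (coord_space (insert j I) - A)"
    unfolding signs_determine_def
  proof (intro ballI allI impI)
    fix x s t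
    assume x: "x \<in> coord_space I" and "\<forall>Q\<in>F. sgn (poly (Q x) s) = sgn (poly (Q x) t)"
    then have "x(j := s) \<in> A \<longleftrightarrow> x(j := t) \<in> A" using signs_determineD[OF A x] by blast
    then show "x(j := s) \<in> coord_space (insert j I) - A \<longleftrightarrow>
        x(j := t) \<in> coord_space (insert j I) - A"
      using coord_space_upd[OF x] by (simp del: fun_upd_apply)
  qed
  with F show ?case by blast
qed

text \<open>
  Substituting a member of \<open>R\<close> for the last variable yields semialgebraic conditions, although \<open>r\<close>
  need not be a polynomial.
\<close>

lemma semialgebraic_section:
  assumes "semialgebraic (insert j I) A" and r: "r \<in> R"
  shows "semialgebraic I {x \<in> coord_space I. x(j := r x) \<in> A}"
  using assms(1)
proof induction
  case (positive p)
  from polynomial_fun_as_poly_family[OF this] obtain n Q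
    where Q: "poly_family n Q" "\<And>x t. p (x(j := t)) = poly (Q x) t" by blast
  have "x(j := r x) \<in> {x \<in> coord_space (insert j I). 0 < p x} \<longleftrightarrow> 0 < poly (Q x) (r x)"
    if "x \<in> coord_space I" for x
    using coord_space_upd[OF that] by (simp add: Q(2) del: fun_upd_apply)
  then have "{x \<in> coord_space I. x(j := r x) \<in> {x \<in> coord_space (insert j I). 0 < p x}} =
      {x. 0 < poly (Q x) (r x)} \<inter> coord_space I" by blast
  moreover have "{x. 0 < poly (Q x) (r x)} \<in> semialgebraic_algebra I"
    by (rule pos_mem[OF eval_mem[OF Q(1) r]])
  ultimately show ?case by (simp only: semialgebraic_algebra_def mem_Collect_eq)
next
  case (union A B)
  have "{x \<in> coord_space I. x(j := r x) \<in> A \<union> B} =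
      {x \<in> coord_space I. x(j := r x) \<in> A} \<union> {x \<in> coord_space I. x(j := r x) \<in> B}" by auto
  also have "semialgebraic I \<dots>" by (rule semialgebraic.union[OF union.IH])
  finally show ?case .
next
  case (inter A B)
  have "{x \<in> coord_space I. x(j := r x) \<in> A \<inter> B} =
      {x \<in> coord_space I. x(j := r x) \<in> A} \<inter> {x \<in> coord_space I. x(j := r x) \<in> B}" by auto
  also have "semialgebraic I \<dots>" by (rule semialgebraic.inter[OF inter.IH])
  finally show ?case .
next
  case (compl A)
  have "{x \<in> coord_space I. x(j := r x) \<in> coord_space (insert j I) - A} =
      coord_space I - {x \<in> coord_space I. x(j := r x) \<in> A}"
    using coord_space_upd[of _ I j] by blast
  also have "semialgebraic I \<dots>" by (rule semialgebraic.compl[OF compl.IH])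
  finally show ?case .
qed

end

lemma semialgebraic_Union:
  assumes "finite E" and "\<And>e. e \<in> E \<Longrightarrow> semialgebraic I (A e)"
  shows "semialgebraic I (\<Union>e\<in>E. A e)"
  using assms
proof (induction E rule: finite_induct)
  case empty
  show ?case using semialgebraic.compl[OF semialgebraic_space[of I]] by simp
next
  case (insert e E)
  then show ?case by (simp add: semialgebraic.union)
qed

text \<open>
  Instead of all reals \<open>t\<close> it is enough to test the sample functions \<open>e \<in> E\<close>, so the projection is the
  union of the finitely many sets obtained by substituting \<open>t = e x\<close>.
\<close>

lemma semialgebraic_project_coordinate:
  assumes A: "semialgebraic (insert j I) A"
  shows "semialgebraic I {x \<in> coord_space I. \<exists>t. x(j := t) \<in> A}"
proof -
  obtain R where R: "{p. polynomial_fun_on I p} \<subseteq> R"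
    "maximal_positivity_ring (semialgebraic_algebra I) R"
    using ex_maximal_positivity_ring[OF polynomials_positivity_ring[of I]]
    by (elim exE conjE) (rule that)
  then interpret semialgebraic_extension I R
    by (auto simp: semialgebraic_extension_def semialgebraic_extension_axioms_def)
  obtain F where F: "finite F" "\<forall>Q\<in>F. \<exists>n. poly_family n Q"
    and inv: "signs_determine j F A"
    using ex_signs_determine[OF A] by (elim exE conjE) (rule that)
  obtain E where E: "finite E" "E \<subseteq> R"
    and sample: "\<forall>x t. \<exists>e\<in>E. \<forall>Q\<in>F. sgn (poly (Q x) (e x)) = sgn (poly (Q x) t)"
    using ex_sign_sample[OF F] by (elim exE conjE) (rule that)
  have "{x \<in> coord_space I. \<exists>t. x(j := t) \<in> A} = (\<Union>e\<in>E. {x \<in> coord_space I. x(j := e x) \<in> A})"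
  proof (intro equalityI subsetI)
    fix x assume x: "x \<in> {x \<in> coord_space I. \<exists>t. x(j := t) \<in> A}"
    then obtain t where t: "x \<in> coord_space I" "x(j := t) \<in> A" by blast
    obtain e where e: "e \<in> E" "\<forall>Q\<in>F. sgn (poly (Q x) (e x)) = sgn (poly (Q x) t)"
      using sample by blast
    have "x(j := e x) \<in> A"
      using signs_determineD[OF inv t(1), of "e x" t] e(2) t(2) by blast
    with t(1) e(1) show "x \<in> (\<Union>e\<in>E. {x \<in> coord_space I. x(j := e x) \<in> A})" by blast
  qed blast
  moreover have "semialgebraic I (\<Union>e\<in>E. {x \<in> coord_space I. x(j := e x) \<in> A})"
    using E semialgebraic_section[OF A] by (intro semialgebraic_Union) auto
  ultimately show ?thesis by simp
qed

lemma semialgebraic_subset: "semialgebraic I A \<Longrightarrow> A \<subseteq> coord_space I"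
  by (induction rule: semialgebraic.induct) auto

text \<open>
  The eliminated coordinates \<open>J\<close> may overlap the remaining ones, so that \<open>J\<close> can be taken to be the set of
  all positions of a tensor.
\<close>

theorem tarski_seidenberg:
  assumes "finite J" and "semialgebraic (I \<union> J) A"
  shows "semialgebraic I {x \<in> coord_space I. \<exists>y\<in>A. \<forall>i\<in>I. y i = x i}"
  using assms
proof (induction J arbitrary: A rule: finite_induct)
  case empty
  then have A: "semialgebraic I A" by simp
  have "{x \<in> coord_space I. \<exists>y\<in>A. \<forall>i\<in>I. y i = x i} = A"
  proof (intro equalityI subsetI)
    fix x assume "x \<in> {x \<in> coord_space I. \<exists>y\<in>A. \<forall>i\<in>I. y i = x i}"
    then obtain y where x: "x \<in> coord_space I" and y: "y \<in> A" "\<forall>i\<in>I. y i = x i" by blast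
    have "y \<in> coord_space I" using semialgebraic_subset[OF A] y(1) by blast
    then have "x = y" using PiE_ext[OF x] y(2) by metis
    with y show "x \<in> A" by simp
  qed (use semialgebraic_subset[OF A] in blast)
  with A show ?case by simp
next
  case (insert j J)
  show ?case
  proof (cases "j \<in> I")
    case True
    then have "I \<union> insert j J = I \<union> J" by blast
    with insert.IH[of A] insert.prems show ?thesis by simp
  next
    case False
    let ?K = "I \<union> J"
    let ?A' = "{z \<in> coord_space ?K. \<exists>t. z(j := t) \<in> A}"
    have K: "semialgebraic (insert j ?K) A" using insert.prems by simp
    have "semialgebraic ?K ?A'" by (rule semialgebraic_project_coordinate[OF K])
    from insert.IH[OF this]
    have IH: "semialgebraic I {x \<in> coord_space I. \<exists>z\<in>?A'. \<forall>i\<in>I. z i = x i}" .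
    have "(\<exists>z\<in>?A'. \<forall>i\<in>I. z i = x i) \<longleftrightarrow> (\<exists>y\<in>A. \<forall>i\<in>I. y i = x i)" for x
    proof
      assume "\<exists>z\<in>?A'. \<forall>i\<in>I. z i = x i"
      then obtain z t where "z(j := t) \<in> A" "\<forall>i\<in>I. z i = x i" by blast
      with False show "\<exists>y\<in>A. \<forall>i\<in>I. y i = x i" by (intro bexI[of _ "z(j := t)"]) auto
    next
      assume "\<exists>y\<in>A. \<forall>i\<in>I. y i = x i"
      then obtain y where y: "y \<in> A" "\<forall>i\<in>I. y i = x i" by blast
      \<comment> \<open>Points of a coordinate space take the value \<open>undefined\<close> off the index set.\<close>
      let ?z = "y(j := undefined)"
      have "y \<in> coord_space (insert j ?K)" using semialgebraic_subset[OF K] y(1) by blast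
      then have "?z \<in> coord_space ?K"
        using False insert.hyps by (auto simp: PiE_iff extensional_def)
      moreover have "?z(j := y j) \<in> A" using y(1) by simp
      ultimately have "?z \<in> ?A'" by blast
      with y(2) False show "\<exists>z\<in>?A'. \<forall>i\<in>I. z i = x i" by (intro bexI[of _ ?z]) auto
    qed
    with IH show ?thesis by simp
  qed
qed

section \<open>Rank-one tensors in the simplex\<close>

definition marginal :: "nat \<Rightarrow> (nat \<Rightarrow> nat) \<Rightarrow> nat \<Rightarrow> nat \<Rightarrow> ((nat \<Rightarrow> nat) \<Rightarrow> real) \<Rightarrow> real"
  where "marginal d n k j t = (\<Sum>i\<in>{i \<in> positions d n. i k = j}. t i)"

lemma finite_positions: "finite (positions d n)"
  unfolding positions_def by (intro finite_PiE) auto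

text \<open>
  Fixing the coordinate \<open>k\<close> of the multi-index leaves a product of index ranges, over which the sum of
  the products factors.
\<close>

lemma marginal_outer_product:
  assumes t: "\<And>i. i \<in> positions d n \<Longrightarrow> t i = (\<Prod>l\<in>{1..d}. v l (i l))"
    and k: "k \<in> {1..d}" and j: "j \<in> {1..n k}"
  shows "marginal d n k j t = v k j * (\<Prod>l\<in>{1..d} - {k}. \<Sum>a\<in>{1..n l}. v l a)"
proof -
  have "{i \<in> positions d n. i k = j} = (\<Pi>\<^sub>E l\<in>{1..d}. if l = k then {j} else {1..n l})"
    (is "?L = ?R")
  proof (intro equalityI subsetI)
    fix i assume "i \<in> ?L"
    then show "i \<in> ?R" by (auto simp: positions_def PiE_iff)
  next
    fix i assume i: "i \<in> ?R"
    have val: "i l \<in> (if l = k then {j} else {1..n l})" if "l \<in> {1..d}" for l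
      by (rule PiE_mem[OF i that])
    have "i l \<in> {1..n l}" if "l \<in> {1..d}" for l
      using val[OF that] j by (cases "l = k") auto
    then have "i \<in> positions d n"
      unfolding positions_def using PiE_arb[OF i] by (intro PiE_I)
    moreover have "i k = j" using val[OF k] by simp
    ultimately show "i \<in> ?L" by simp
  qed
  then have "marginal d n k j t =
      (\<Sum>i\<in>(\<Pi>\<^sub>E l\<in>{1..d}. if l = k then {j} else {1..n l}). \<Prod>l\<in>{1..d}. v l (i l))"
    unfolding marginal_def using t by (intro sum.cong) auto
  also have "\<dots> = (\<Prod>l\<in>{1..d}. \<Sum>a\<in>(if l = k then {j} else {1..n l}). v l a)"
    by (rule prod_sum_PiE[symmetric]) auto
  also have "\<dots> = v k j * (\<Prod>l\<in>{1..d} - {k}. \<Sum>a\<in>{1..n l}. v l a)"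
    using k by (subst prod.remove[of _ k]) (auto intro!: prod.cong)
  finally show ?thesis .
qed

text \<open>
  A rank-one tensor with entry sum \<open>1\<close> is the outer product of its own marginals: if
  \<open>t = v\<^sub>1 \<otimes> \<dots> \<otimes> v\<^sub>d\<close> and \<open>s\<^sub>k\<close> is the entry sum of \<open>v\<^sub>k\<close>, then \<open>s\<^sub>1 \<cdots> s\<^sub>d = 1\<close>, so the \<open>k\<close>-th marginal is
  \<open>v\<^sub>k / s\<^sub>k\<close> and the scalars cancel in the product. This expresses rank one by polynomial equations
  in the entries of \<open>t\<close> alone, with no auxiliary vectors to eliminate.
\<close>

lemma rank_one_iff_product_of_marginals:
  assumes sum: "(\<Sum>i\<in>positions d n. t i) = 1"
  shows "rank_one d n t \<longleftrightarrow>
    (\<forall>i\<in>positions d n. t i = (\<Prod>k\<in>{1..d}. marginal d n k (i k) t))"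
proof
  assume "rank_one d n t"
  then obtain v where v: "\<And>i. i \<in> positions d n \<Longrightarrow> t i = (\<Prod>k\<in>{1..d}. v k (i k))"
    unfolding rank_one_def by blast
  define s where "s l = (\<Sum>a\<in>{1..n l}. v l a)" for l
  have s1: "(\<Prod>l\<in>{1..d}. s l) = 1"
  proof -
    have "(\<Prod>l\<in>{1..d}. s l) = (\<Sum>i\<in>positions d n. \<Prod>l\<in>{1..d}. v l (i l))"
      unfolding s_def positions_def by (rule prod_sum_PiE) auto
    also have "\<dots> = (\<Sum>i\<in>positions d n. t i)" using v by (intro sum.cong) auto
    finally show ?thesis using sum by simp
  qed
  have rest: "(\<Prod>l\<in>{1..d} - {k}. s l) = inverse (s k)" if "k \<in> {1..d}" for k
  proof -
    have "s k * (\<Prod>l\<in>{1..d} - {k}. s l) = 1"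
      using s1 that by (simp flip: prod.remove)
    then show ?thesis by (metis inverse_unique)
  qed
  show "\<forall>i\<in>positions d n. t i = (\<Prod>k\<in>{1..d}. marginal d n k (i k) t)"
  proof
    fix i assume i: "i \<in> positions d n"
    have "(\<Prod>k\<in>{1..d}. marginal d n k (i k) t) = (\<Prod>k\<in>{1..d}. v k (i k) * inverse (s k))"
    proof (rule prod.cong[OF refl])
      fix k assume k: "k \<in> {1..d}"
      then have "i k \<in> {1..n k}" using i by (auto simp: positions_def PiE_iff)
      from marginal_outer_product[of d n t v k "i k", OF v k this]
      show "marginal d n k (i k) t = v k (i k) * inverse (s k)"
        using rest[OF k] by (simp add: s_def)
    qed
    also have "\<dots> = (\<Prod>k\<in>{1..d}. v k (i k)) * inverse (\<Prod>k\<in>{1..d}. s k)"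
      by (simp add: prod.distrib prod_inversef[unfolded o_def])
    also have "\<dots> = t i" using v[OF i] s1 by simp
    finally show "t i = (\<Prod>k\<in>{1..d}. marginal d n k (i k) t)" by simp
  qed
next
  assume "\<forall>i\<in>positions d n. t i = (\<Prod>k\<in>{1..d}. marginal d n k (i k) t)"
  moreover have "\<exists>i\<in>positions d n. t i \<noteq> 0"
    using sum sum.neutral[of "positions d n" t] by fastforce
  ultimately show "rank_one d n t"
    unfolding rank_one_def by (intro conjI exI[of _ "\<lambda>k j. marginal d n k j t"])
qed

lemma semialgebraic_rank_one_simplex:
  "semialgebraic (positions d n) {t \<in> standard_simplex d n. rank_one d n t}"
proof -
  let ?P = "positions d n"
  have marginal: "polynomial_fun_on ?P (marginal d n k j)" for k j
    unfolding marginal_def[abs_def]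
    by (intro polynomial_fun_on_sum polynomial_fun_on.coord) simp
  have "{t \<in> standard_simplex d n. rank_one d n t} =
      {t \<in> coord_space ?P. \<forall>i\<in>?P. 0 \<le> t i} \<inter>
      ({t \<in> coord_space ?P. (\<Sum>i\<in>?P. t i) = 1} \<inter>
       {t \<in> coord_space ?P. \<forall>i\<in>?P. t i = (\<Prod>k\<in>{1..d}. marginal d n k (i k) t)})"
    using rank_one_iff_product_of_marginals by (auto simp: standard_simplex_def tensors_def)
  then show ?thesis
    by (auto intro!: semialgebraic.inter semialgebraic_ball finite_positions semialgebraic_le
        semialgebraic_eq polynomial_fun_on.const polynomial_fun_on.coord polynomial_fun_on_sum
        polynomial_fun_on_prod marginal)
qed

theorem proposition5p1:
  fixes d :: nat and n :: "nat \<Rightarrow> nat" and S :: "(nat \<Rightarrow> nat) set"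
  assumes "d \<ge> 1"
    and "\<And>k. k \<in> {1..d} \<Longrightarrow> n k \<ge> 1"
    and "S \<subseteq> positions d n"
  shows "semialgebraic S {x \<in> coord_space S. completable d n S x}"
proof -
  have "semialgebraic (S \<union> positions d n) {t \<in> standard_simplex d n. rank_one d n t}"
    using semialgebraic_rank_one_simplex assms(3) by (simp add: Un_absorb1)
  from tarski_seidenberg[OF finite_positions this] show ?thesis
    by (simp add: completable_def Bex_def conj_assoc)
qed

end
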